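(* Let $d \geq 1$ be a fixed integer. Let $n \geq d$ and suppose that the correlation polytope $\mathrm{COR}(n)$ has a $(\mathbf{S}^d_+)^r$-lift for some $r \in \mathbb{N}$. Then \[ r \;\geq\; \kappa(d)\cdot c(d)^n, \] where $c(d) = (1-1/3^{d})^{-1/d} > 1$ and $\kappa(d) = (3^{d}-1)^{-(1-1/d)}$. Moreover, in the special case $d=2$ the constants can be taken to be $\kappa(2) = \frac{1}{\sqrt{7}}$ and $c(2) = \sqrt{\frac{9}{7}}$; that is, if $n \ge 2$ and $\mathrm{COR}(n)$ has a $(\mathbf{S}^2_+)^r$-lift, then $r \geq \frac{1}{\sqrt{7}}\left(\sqrt{9/7}\right)^n$.
   Context: The correlation polytope is $\mathrm{COR}(n) = \mathrm{conv}\{ bb^T : b \in \{0,1\}^n\}$, a polytope in the space of real symmetric $n\times n$ matrices. $\mathbf{S}^d_+$ denotes the cone of $d\times d$ real symmetric positive semidefinite matrices, and $(\mathbf{S}^d_+)^r = \mathbf{S}^d_+\times\dots\times\mathbf{S}^d_+$ ($r$ copies), viewed as a cone in the space $(\mathbf{S}^d)^r$ of $r$-tuples of real symmetric $d\times d$ matrices. A polytope $P$ has a $(\mathbf{S}^d_+)^r$-lift if there exist an affine subspace $L$ of $(\mathbf{S}^d)^r$ and a linear map $\pi$ from $(\mathbf{S}^d)^r$ to the ambient space of $P$ such that $P = \pi((\mathbf{S}^d_+)^r \cap L)$. *)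

theory Defs
  imports "HOL-Analysis.Analysis"
begin

definition COR :: "(real^'n^'n) set" where
  "COR = convex hull {(\<chi> i j. b $ i * b $ j) | b :: real^'n. \<forall>i. b $ i \<in> {0, 1}}"

definition psd :: "real^'d^'d \<Rightarrow> bool" where
  "psd A \<longleftrightarrow> transpose A = A \<and> (\<forall>x. 0 \<le> x \<bullet> (A *v x))"

text \<open>
  The space of \<open>r\<close>-tuples of symmetric matrices is indexed by a set \<open>R\<close> with
  \<open>card R = r\<close>, where \<open>R\<close> is a subset of a finite type: the components outside \<open>R\<close>
  are zero. Index types are nonempty, so indexing by the whole type would leave out \<open>r = 0\<close>.
\<close>

definition sym_tuples :: "'r set \<Rightarrow> (real^'d^'d^'r) set" where
  "sym_tuples R = {X. (\<forall>i\<in>R. transpose (X $ i) = X $ i) \<and> (\<forall>i. i \<notin> R \<longrightarrow> X $ i = 0)}"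

definition psd_tuples :: "'r set \<Rightarrow> (real^'d^'d^'r) set" where
  "psd_tuples R = {X. (\<forall>i\<in>R. psd (X $ i)) \<and> (\<forall>i. i \<notin> R \<longrightarrow> X $ i = 0)}"

text \<open>
  The type argument fixes the size \<open>d = CARD('d)\<close> of the blocks. The map is linear on the
  whole type rather than on \<open>sym_tuples R\<close> only; this is no restriction, since a linear map on a
  subspace extends to a linear map on the whole space.
\<close>

definition has_psd_lift ::
  "'d::finite itself \<Rightarrow> 'r::finite set \<Rightarrow> 'v::real_vector set \<Rightarrow> bool" where
  "has_psd_lift _ R P \<longleftrightarrow>
    (\<exists>(L :: (real^'d^'d^'r) set) (\<pi> :: real^'d^'d^'r \<Rightarrow> 'v).
      affine L \<and> L \<subseteq> sym_tuples R \<and> linear \<pi> \<and> P = \<pi> ` (psd_tuples R \<inter> L))"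

definition lift_base :: "nat \<Rightarrow> real" where
  "lift_base d = (1 - 1 / 3 ^ d) powr (- 1 / real d)"

definition lift_factor :: "nat \<Rightarrow> real" where
  "lift_factor d = (3 ^ d - 1) powr (- (1 - 1 / real d))"

end

theory Submission
  imports Defs
begin

text \<open>
  For subsets \<open>a\<close>, \<open>b\<close> the number \<open>(1 - |a \<inter> b|)\<^sup>2\<close> is the slack of the vertex \<open>bb\<^sup>T\<close> in the
  inequality \<open>\<langle>2 diag(a) - aa\<^sup>T, P\<rangle> \<le> 1\<close>, so by conic duality a lift writes it as a sum over \<open>R\<close> of
  inner products \<open>\<langle>A\<^sub>i(a), B\<^sub>i(b)\<rangle>\<close> of positive semidefinite matrices of size \<open>d\<close>. Every term
  vanishes when \<open>|a \<inter> b| = 1\<close>, while each of the \<open>3\<^sup>n\<close> disjoint pairs has a nonzero term. It remains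
  to bound the number of disjoint pairs at which a single term is nonzero.

  Restricted to a block of \<open>d\<close> elements, a term cannot be nonzero at all \<open>3\<^sup>d\<close> disjoint pairs: the pairs
  \<open>({x\<^sub>0,\<dots>,x\<^sub>i\<^sub>-\<^sub>1}, {x\<^sub>i})\<close> for \<open>i < d\<close> and the pair \<open>({x\<^sub>0,\<dots>,x\<^sub>d\<^sub>-\<^sub>1}, {})\<close> would give vectors
  \<open>u\<^sub>i\<close>, \<open>v\<^sub>i\<close> with a triangular inner product matrix of size \<open>d + 1\<close>. This saves at least one of the \<open>3\<^sup>d\<close>
  cells: with \<open>K = 3\<^sup>d - 1\<close> rectangles inside the disjointness matrix of the block, always at least as
  many rectangles as cells are met, and \<open>K = 7\<close> rectangles suffice for \<open>d = 2\<close>. Peeling off blocks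
  bounds the count by \<open>K\<^sup>q 3\<^sup>s\<close> where \<open>n = d q + s\<close>.
\<close>

section \<open>Gram representations of positive semidefinite matrices\<close>

definition outer :: "real^'m \<Rightarrow> real^'m^'m" where
  "outer u = (\<chi> i j. u $ i * u $ j)"

lemma inner_outer: "A \<bullet> outer u = u \<bullet> (A *v u)"
  by (simp add: inner_vec_def matrix_vector_mult_def outer_def sum_distrib_left mult_ac)

lemma outer_vector_mult: "outer u *v x = (u \<bullet> x) *\<^sub>R u"
  by (simp add: vec_eq_iff inner_vec_def matrix_vector_mult_def outer_def sum_distrib_left sum_distrib_right mult_ac)

lemma outer_inner_outer: "outer u \<bullet> outer v = (u \<bullet> v)\<^sup>2"
  by (simp add: inner_outer outer_vector_mult inner_commute power2_eq_square)

lemma transpose_outer: "transpose (outer u) = outer u"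
  by (simp add: transpose_def outer_def vec_eq_iff mult.commute)

lemma psd_outer: "psd (outer u)"
  unfolding psd_def
  by (simp add: transpose_outer outer_vector_mult inner_commute)

lemma inner_symmetric_matrix:
  fixes A :: "real^'m^'m"
  assumes "transpose A = A"
  shows "x \<bullet> (A *v y) = y \<bullet> (A *v x)"
  by (metis assms dot_lmul_matrix inner_commute transpose_matrix_vector)

text \<open>The form is nonnegative at every combination of \<open>x\<close> and \<open>y\<close>. A
  suitable combination gives the inequality when \<open>r > 0\<close>; the degenerate case
  \<open>r = 0\<close> needs its own choice.\<close>

lemma psd_Cauchy_Schwarz:
  fixes A :: "real^'m^'m"
  assumes "psd A"
  shows "(x \<bullet> (A *v y))\<^sup>2 \<le> (x \<bullet> (A *v x)) * (y \<bullet> (A *v y))"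
proof -
  define p q r where "p = x \<bullet> (A *v x)" and "q = x \<bullet> (A *v y)" and "r = y \<bullet> (A *v y)"
  have sym: "y \<bullet> (A *v x) = q"
    unfolding q_def using assms inner_symmetric_matrix psd_def by metis
  have quad: "0 \<le> s\<^sup>2 * p + 2 * s * t * q + t\<^sup>2 * r" for s t
  proof -
    have "0 \<le> (s *\<^sub>R x + t *\<^sub>R y) \<bullet> (A *v (s *\<^sub>R x + t *\<^sub>R y))"
      using assms psd_def by blast
    also have "\<dots> = s\<^sup>2 * p + 2 * s * t * q + t\<^sup>2 * r"
      using sym unfolding p_def q_def r_def
      by (simp add: matrix_vector_right_distrib scaleR_matrix_vector_assoc[symmetric]
          matrix_vector_mult_scaleR inner_add_left inner_add_right power2_eq_square algebra_simps)
    finally show ?thesis .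
  qed
  have r0: "r \<ge> 0" using assms unfolding psd_def r_def by blast
  show ?thesis
  proof (cases "r = 0")
    case True
    have "q = 0"
    proof (rule ccontr)
      assume "q \<noteq> 0"
      \<comment> \<open>At these coefficients the form would be -1.\<close>
      then show False using quad[of 1 "- (p + 1) / (2 * q)"] True by (simp add: field_simps)
    qed
    then show ?thesis by (simp add: p_def[symmetric] q_def[symmetric] r_def[symmetric] True)
  next
    case False
    \<comment> \<open>The form at \<open>s = r\<close>, \<open>t = -q\<close> is exactly this
      product.\<close>
    have "0 \<le> r * (r * p - q\<^sup>2)"
      using quad[of r "-q"] by (simp add: power2_eq_square algebra_simps)
    then have "0 \<le> r * p - q\<^sup>2" using False r0 by (simp add: zero_le_mult_iff)
    then show ?thesis by (simp add: p_def[symmetric] q_def[symmetric] r_def[symmetric] mult.commute)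
  qed
qed

lemma psd_form_zeroD:
  fixes A :: "real^'m^'m"
  assumes "psd A" "x \<bullet> (A *v x) = 0"
  shows "A *v x = 0"
  using psd_Cauchy_Schwarz[OF assms(1), of "A *v x" x] assms(2) by simp

lemma psd_add: "psd A \<Longrightarrow> psd B \<Longrightarrow> psd (A + B)"
  by (simp add: psd_def transpose_def vec_eq_iff matrix_vector_mult_add_rdistrib inner_add_right)

lemma psd_scaleR: "psd A \<Longrightarrow> 0 \<le> c \<Longrightarrow> psd (c *\<^sub>R A)"
  by (simp add: psd_def transpose_def vec_eq_iff scaleR_matrix_vector_assoc[symmetric])

lemma psd_0: "psd 0"
  by (simp add: psd_def transpose_def vec_eq_iff)

lemma psd_mat_1: "psd (mat 1)"
  by (simp add: psd_def transpose_mat)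

lemma psd_sum: "(\<And>i. i \<in> I \<Longrightarrow> psd (f i)) \<Longrightarrow> psd (sum f I)"
  by (induction I rule: infinite_finite_induct) (auto simp: psd_0 psd_add)

text \<open>Peel off one rank-one term at a time: \<open>u\<close> is \<open>A *v x\<close> scaled
  so that subtracting \<open>outer u\<close> puts \<open>x\<close> into the kernel, while
  Cauchy-Schwarz keeps the rest positive semidefinite. The measure is the rank, which drops because
  the kernel grows strictly.\<close>

lemma psd_imp_Gram:
  fixes A :: "real^'m^'m"
  assumes "psd A"
  shows "\<exists>us. A = (\<Sum>u\<leftarrow>us. outer u)"
  using assms
proof (induction "CARD('m) - dim {x. A *v x = 0}" arbitrary: A rule: less_induct)
  case less
  show ?case
  proof (cases "\<forall>x. x \<bullet> (A *v x) = 0")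
    case True
    then have "A = 0"
      using psd_form_zeroD[OF less.prems] by (metis matrix_eq matrix_vector_mult_0)
    then show ?thesis by (intro exI[of _ "[]"]) simp
  next
    case False
    then obtain x where x: "x \<bullet> (A *v x) > 0"
      using less.prems unfolding psd_def by (metis order_le_less)
    define u where "u = (1 / sqrt (x \<bullet> (A *v x))) *\<^sub>R (A *v x)"
    define B where "B = A - outer u"
    have Bv: "B *v y = A *v y - (u \<bullet> y) *\<^sub>R u" for y
      by (simp add: B_def matrix_vector_mult_diff_rdistrib outer_vector_mult)
    have uy: "u \<bullet> y = (y \<bullet> (A *v x)) / sqrt (x \<bullet> (A *v x))" for y
      by (simp add: u_def inner_commute)
    have "psd B"
      unfolding psd_def
    proof (intro conjI allI)
      have "transpose A = A" using less.prems psd_def by blast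
      then show "transpose B = B"
        unfolding B_def using transpose_outer[of u] by (simp add: transpose_def vec_eq_iff)
      fix y
      have "(u \<bullet> y)\<^sup>2 = (y \<bullet> (A *v x))\<^sup>2 / (x \<bullet> (A *v x))"
        using x by (simp add: uy power_divide)
      also have "\<dots> \<le> y \<bullet> (A *v y)"
        using psd_Cauchy_Schwarz[OF less.prems, of y x] x by (simp add: field_simps)
      finally show "0 \<le> y \<bullet> (B *v y)"
        by (simp add: Bv inner_diff_right power2_eq_square inner_commute)
    qed
    have sub: "{y. A *v y = 0} \<subseteq> {y. B *v y = 0}"
    proof clarify
      fix y assume "A *v y = 0"
      moreover from this have "u \<bullet> y = 0"
        unfolding uy using inner_symmetric_matrix[of A y x] less.prems by (simp add: psd_def)
      ultimately show "B *v y = 0" by (simp add: Bv)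
    qed
    have "B *v x = 0"
    proof -
      have "(u \<bullet> x) *\<^sub>R u = A *v x"
        using x unfolding uy by (simp add: u_def)
      then show ?thesis by (simp add: Bv)
    qed
    moreover have "A *v x \<noteq> 0" using x by auto
    ultimately have psub: "{y. A *v y = 0} \<subset> {y. B *v y = 0}" using sub by blast
    have subsp: "subspace {y. M *v y = 0}" for M :: "real^'m^'m"
      by (simp add: subspace_def matrix_vector_right_distrib matrix_vector_mult_scaleR)
    have "dim {y. A *v y = 0} < dim {y. B *v y = 0}"
      using psub by (intro dim_psubset) (metis span_eq_iff subsp)
    moreover have "dim {y. B *v y = 0} \<le> CARD('m)"
      using dim_subset_UNIV[of "{y. B *v y = 0}"] by simp
    ultimately obtain us where "B = (\<Sum>u\<leftarrow>us. outer u)"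
      using less.hyps[OF _ \<open>psd B\<close>] by fastforce
    then have "A = (\<Sum>u\<leftarrow>u # us. outer u)" by (simp add: B_def algebra_simps)
    then show ?thesis by blast
  qed
qed

lemma inner_Gram:
  "(\<Sum>u\<leftarrow>us. outer u) \<bullet> (\<Sum>v\<leftarrow>vs. outer v) = (\<Sum>u\<leftarrow>us. \<Sum>v\<leftarrow>vs. (u \<bullet> v)\<^sup>2)"
proof -
  have "outer u \<bullet> (\<Sum>v\<leftarrow>vs. outer v) = (\<Sum>v\<leftarrow>vs. (u \<bullet> v)\<^sup>2)" for u :: "real^'a"
    by (induction vs) (auto simp: inner_add_right outer_inner_outer)
  then show ?thesis by (induction us) (auto simp: inner_add_left)
qed

text \<open>A sum of squares vanishes only termwise. This turns vanishing inner products of matrices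
  into orthogonality of vector sets, the form in which the combinatorial part sees the
  matrices.\<close>

lemma inner_Gram_eq_0_iff:
  "(\<Sum>u\<leftarrow>us. outer u) \<bullet> (\<Sum>v\<leftarrow>vs. outer v) = 0 \<longleftrightarrow> (\<forall>u\<in>set us. \<forall>v\<in>set vs. u \<bullet> v = 0)"
proof -
  have "(\<Sum>v\<leftarrow>vs. (u \<bullet> v)\<^sup>2) = 0 \<longleftrightarrow> (\<forall>v\<in>set vs. u \<bullet> v = 0)" for u :: "real^'a"
    by (subst sum_list_nonneg_eq_0_iff) auto
  then show ?thesis
    unfolding inner_Gram
    by (subst sum_list_nonneg_eq_0_iff) (auto intro!: sum_list_nonneg)
qed

lemma psd_inner_nonneg:
  assumes "psd A" "psd B"
  shows "0 \<le> A \<bullet> B"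
proof -
  obtain us vs where "A = (\<Sum>u\<leftarrow>us. outer u)" "B = (\<Sum>v\<leftarrow>vs. outer v)"
    using assms psd_imp_Gram by meson
  then show ?thesis by (auto simp: inner_Gram intro!: sum_list_nonneg)
qed

text \<open>With \<open>B\<close> in Gram form, \<open>A \<bullet> B\<close> is a sum of nonnegative
  terms \<open>u \<bullet> (A *v u)\<close>, so every Gram vector of \<open>B\<close> lies in the
  kernel of \<open>A\<close>; these vectors span the range of \<open>B\<close>.\<close>

lemma psd_inner_eq_0D:
  assumes "psd A" "psd B" "A \<bullet> B = 0"
  shows "A *v (B *v x) = 0"
proof -
  obtain us where us: "B = (\<Sum>u\<leftarrow>us. outer u)" using assms psd_imp_Gram by meson
  have "A \<bullet> B = (\<Sum>u\<leftarrow>us. u \<bullet> (A *v u))"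
    unfolding us by (induction us) (auto simp: inner_add_right inner_outer)
  then have "(\<Sum>u\<leftarrow>us. u \<bullet> (A *v u)) = 0" using assms by simp
  then have "\<forall>u\<in>set us. u \<bullet> (A *v u) = 0"
    using assms(1) by (subst (asm) sum_list_nonneg_eq_0_iff) (auto simp: psd_def)
  then have "\<forall>u\<in>set us. A *v u = 0" using psd_form_zeroD[OF assms(1)] by blast
  then show ?thesis
    unfolding us
    by (induction us) (auto simp: matrix_vector_mult_add_rdistrib outer_vector_mult
        matrix_vector_right_distrib matrix_vector_mult_scaleR)
qed

section \<open>Semidefinite duality and factorization of the slack matrix\<close>

text \<open>Serves to show that a separating functional is symmetric: nonnegativity of
  \<open>A \<bullet> (transpose A - A)\<close> forces \<open>transpose A = A\<close>.\<close>

lemma norm_transpose_diff: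
  fixes A :: "real^'m^'m"
  shows "(transpose A - A) \<bullet> (transpose A - A) = - 2 * (A \<bullet> (transpose A - A))"
proof -
  have "transpose A \<bullet> transpose A = A \<bullet> A"
    unfolding inner_vec_def transpose_def vec_lambda_beta by (rule sum.swap)
  then show ?thesis by (simp add: inner_diff_left inner_diff_right inner_commute)
qed

text \<open>
  The lift need not contain a positive definite point, so duality is applied over the face of the
  cone generated by the lifted points: \<open>C\<close> consists of the tuples whose forms are nonnegative on the
  ranges of the barycentre \<open>M\<close>, for which \<open>M\<close> is an interior point of the cone.
\<close>

lemma psd_duality_certificate:
  fixes X :: "'b \<Rightarrow> real^'d^'d^'r" and g :: "real^'d^'d^'r \<Rightarrow> real"
  assumes I: "finite I" "I \<noteq> {}"
    and psdX: "\<And>b i. b \<in> I \<Longrightarrow> psd (X b $ i)"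
    and lin: "linear g"
    and bound: "\<And>Y. Y \<in> affine hull X ` I \<Longrightarrow> (\<And>i. psd (Y $ i)) \<Longrightarrow> g Y \<le> 1"
  shows "\<exists>W c. 0 \<le> c \<and> (\<forall>i. psd (W $ i)) \<and> (\<forall>b\<in>I. 1 - g (X b) = W \<bullet> X b + c)"
proof -
  interpret g: linear g by fact
  define L where "L = affine hull X ` I"
  define M where "M = (\<Sum>b\<in>I. (1 / real (card I)) *\<^sub>R X b)"
  define C where "C = {Z :: real^'d^'d^'r. \<forall>i x. 0 \<le> (M $ i *v x) \<bullet> (Z $ i *v (M $ i *v x))}"
  \<comment> \<open>If \<open>D\<close> contained 0, some positive semidefinite point of
    \<open>L\<close> would have \<open>g Y > 1\<close>. The hyperplane separating 0 from
    \<open>D\<close> supplies the certificate.\<close>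
  define D where "D = {(Z - Y, t) | Z Y t. Z \<in> C \<and> Y \<in> L \<and> 1 - g Y < t}"
  have XL: "X b \<in> L" if "b \<in> I" for b unfolding L_def using that by (simp add: hull_inc)
  have affL: "affine L" unfolding L_def by (rule affine_affine_hull)
  have mem_ML: "M \<in> L"
  proof -
    have "M \<in> convex hull X ` I"
      unfolding M_def using I by (intro convex_sum) (auto simp: hull_inc)
    then show ?thesis unfolding L_def using convex_hull_subset_affine_hull by blast
  qed
  have Mi: "M $ i = (\<Sum>b\<in>I. (1 / real (card I)) *\<^sub>R (X b $ i))" for i
    unfolding M_def by (simp add: sum_component)
  have psdM: "psd (M $ i)" for i
    unfolding Mi using psdX by (intro psd_sum psd_scaleR) auto
  have C_add: "Z + Z' \<in> C" if "Z \<in> C" "Z' \<in> C" for Z Z'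
    using that unfolding C_def by (auto simp: matrix_vector_mult_add_rdistrib inner_add_right)
  have C_scale: "s *\<^sub>R Z \<in> C" if "Z \<in> C" "0 \<le> s" for s Z
    using that unfolding C_def by (auto simp: scaleR_matrix_vector_assoc[symmetric])
  have C_psd: "Z \<in> C" if "\<And>i. psd (Z $ i)" for Z
    using that unfolding C_def psd_def by blast
  \<comment> \<open>The forms of the \<open>X b\<close> are nonnegative and average to that of
    \<open>M\<close>, so each vanishes where the form of \<open>M\<close> does.\<close>
  have kerX: "X b $ i *v k = 0" if "b \<in> I" "M $ i *v k = 0" for b i k
  proof -
    have "(\<Sum>b\<in>J. c * (k \<bullet> (X b $ i *v k))) = k \<bullet> ((\<Sum>b\<in>J. c *\<^sub>R (X b $ i)) *v k)" for J c
      by (induction J rule: infinite_finite_induct)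
        (auto simp: matrix_vector_mult_add_rdistrib inner_add_right scaleR_matrix_vector_assoc[symmetric])
    then have "(\<Sum>b\<in>I. (1 / real (card I)) * (k \<bullet> (X b $ i *v k))) = k \<bullet> (M $ i *v k)"
      unfolding Mi by blast
    then have "(\<Sum>b\<in>I. (1 / real (card I)) * (k \<bullet> (X b $ i *v k))) = 0" using that by simp
    then have "(1 / real (card I)) * (k \<bullet> (X b $ i *v k)) = 0"
      using that(1) I psdX by (subst (asm) sum_nonneg_eq_0_iff) (auto simp: psd_def)
    then show ?thesis using psd_form_zeroD psdX that(1) I by (auto simp: card_eq_0_iff)
  qed
  \<comment> \<open>Linear conditions that hold at every \<open>X b\<close> pass to the affine
    hull.\<close>
  have L_ker: "transpose (Y $ i) = Y $ i \<and> (\<forall>k. M $ i *v k = 0 \<longrightarrow> Y $ i *v k = 0)"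
    if "Y \<in> L" for Y i
  proof -
    let ?T = "{Y :: real^'d^'d^'r. \<forall>i. transpose (Y $ i) = Y $ i \<and> (\<forall>k. M $ i *v k = 0 \<longrightarrow> Y $ i *v k = 0)}"
    have "subspace ?T"
      by (auto simp: subspace_def transpose_def vec_eq_iff matrix_vector_mult_add_rdistrib
          scaleR_matrix_vector_assoc[symmetric])
    moreover have "X ` I \<subseteq> ?T" using kerX psdX by (auto simp: psd_def)
    ultimately have "L \<subseteq> ?T" unfolding L_def by (intro hull_minimal subspace_imp_affine)
    then show ?thesis using that by blast
  qed
  have L_C: "psd (Y $ i)" if "Y \<in> L" "Y \<in> C" for Y i
    unfolding psd_def
  proof (intro conjI allI)
    show sym: "transpose (Y $ i) = Y $ i" using L_ker that by blast
    fix y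
    \<comment> \<open>Split \<open>y\<close> along the range of \<open>M $ i\<close> and its
      orthogonal complement. The second part lies in the kernel of the symmetric
      \<open>M $ i\<close>, hence is killed by \<open>Y $ i\<close>; on the first, membership in
      \<open>C\<close> gives nonnegativity.\<close>
    obtain a k where a: "a \<in> span (range ((*v) (M $ i)))"
      and k: "\<And>w. w \<in> span (range ((*v) (M $ i))) \<Longrightarrow> orthogonal k w" and y: "y = a + k"
      using orthogonal_subspace_decomp_exists[of "range ((*v) (M $ i))" y] by metis
    have "subspace (range ((*v) (M $ i)))"
      using subspace_UNIV linear_subspace_image matrix_vector_mul_linear by blast
    then obtain x where x: "a = M $ i *v x" using a by (metis span_eq_iff imageE)
    have "k \<bullet> (M $ i *v w) = 0" for w
      using k[of "M $ i *v w"] by (simp add: orthogonal_def span_base)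
    then have "(M $ i *v k) \<bullet> (M $ i *v k) = 0"
      using inner_symmetric_matrix[of "M $ i" k "M $ i *v k"] psdM[of i] by (simp add: psd_def)
    then have Yk: "Y $ i *v k = 0" using L_ker[OF that(1)] by simp
    have "y \<bullet> (Y $ i *v y) = a \<bullet> (Y $ i *v a)"
      using inner_symmetric_matrix[OF sym, of k a]
      by (simp add: y matrix_vector_right_distrib Yk inner_add_left)
    then show "0 \<le> y \<bullet> (Y $ i *v y)" using that(2) x unfolding C_def by simp
  qed
  have "convex D"
  proof (rule convexI)
    fix p q :: "(real^'d^'d^'r) \<times> real" and u v :: real
    assume pq: "p \<in> D" "q \<in> D" and uv: "0 \<le> u" "0 \<le> v" "u + v = 1"
    obtain Z Y t where p: "p = (Z - Y, t)" "Z \<in> C" "Y \<in> L" "1 - g Y < t" using pq unfolding D_def by blast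
    obtain Z' Y' t' where q: "q = (Z' - Y', t')" "Z' \<in> C" "Y' \<in> L" "1 - g Y' < t'"
      using pq unfolding D_def by blast
    have Y: "u *\<^sub>R Y + v *\<^sub>R Y' \<in> L" using mem_affine[OF affL] p q uv by blast
    have Z: "u *\<^sub>R Z + v *\<^sub>R Z' \<in> C" using C_add C_scale p q uv by blast
    have "1 - g (u *\<^sub>R Y + v *\<^sub>R Y') = u * (1 - g Y) + v * (1 - g Y')"
      using uv by (simp add: g.add g.scale algebra_simps)
    \<comment> \<open>Strictness needs a positive weight; if \<open>u\<close> is zero, then
      \<open>v\<close> is one.\<close>
    also have "\<dots> < u * t + v * t'"
    proof (cases "u = 0")
      case True then show ?thesis using q uv by simp
    next
      case False
      then have "u * (1 - g Y) < u * t" using p uv by simp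
      moreover have "v * (1 - g Y') \<le> v * t'" using q uv by (intro mult_left_mono) auto
      ultimately show ?thesis by linarith
    qed
    finally have t: "1 - g (u *\<^sub>R Y + v *\<^sub>R Y') < u * t + v * t'" .
    have "u *\<^sub>R p + v *\<^sub>R q = ((u *\<^sub>R Z + v *\<^sub>R Z') - (u *\<^sub>R Y + v *\<^sub>R Y'), u * t + v * t')"
      by (simp add: p(1) q(1) algebra_simps)
    then show "u *\<^sub>R p + v *\<^sub>R q \<in> D" unfolding D_def using Y Z t by blast
  qed
  moreover have "0 \<notin> D"
  proof
    assume "0 \<in> D"
    then obtain Z Y where "Z = Y" "Z \<in> C" "Y \<in> L" "1 - g Y < 0"
      unfolding D_def zero_prod_def by auto
    then show False using bound[of Y] L_C unfolding L_def by fastforce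
  qed
  ultimately obtain p where p: "p \<noteq> 0" "\<forall>x\<in>D. 0 \<le> p \<bullet> x"
    using separating_hyperplane_set_0 by blast
  obtain W \<mu> where W\<mu>: "p = (W, \<mu>)" by (cases p)
  have sep: "0 \<le> W \<bullet> (Z - Y) + \<mu> * t" if "Z \<in> C" "Y \<in> L" "1 - g Y < t" for Z Y t
  proof -
    have "(Z - Y, t) \<in> D" unfolding D_def using that by blast
    then show ?thesis using p(2) W\<mu> by fastforce
  qed
  have MC: "M \<in> C" using C_psd psdM by blast
  have zC: "0 \<in> C" by (rule C_psd) (simp add: psd_0)
  have "\<mu> \<ge> 0"
  proof (rule ccontr)
    assume "\<not> \<mu> \<ge> 0"
    \<comment> \<open>The value \<open>2 - g M\<close> exceeds \<open>1 - g M\<close>, as membership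
      in \<open>D\<close> demands, and the maximum with 1 keeps it positive.\<close>
    then have "\<mu> * max 1 (2 - g M) < 0" by (simp add: mult_neg_pos)
    moreover have "0 \<le> \<mu> * max 1 (2 - g M)" using sep[OF MC mem_ML, of "max 1 (2 - g M)"] by simp
    ultimately show False by linarith
  qed
  have WC: "0 \<le> W \<bullet> Z" if "Z \<in> C" for Z
  proof (rule ccontr)
    assume neg: "\<not> 0 \<le> W \<bullet> Z"
    define e where "e = \<mu> * (2 - g M) - W \<bullet> M"
    \<comment> \<open>\<open>C\<close> is a cone, so \<open>Z\<close> may be scaled until the
      separation inequality would assert that \<open>e - \<bar>e\<bar> - 1\<close> is
      nonnegative.\<close>
    define s where "s = (\<bar>e\<bar> + 1) / (- (W \<bullet> Z))"
    have "0 \<le> s" unfolding s_def using neg by (intro divide_nonneg_nonneg) auto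
    then have "0 \<le> W \<bullet> (s *\<^sub>R Z - M) + \<mu> * (2 - g M)"
      using sep C_scale that mem_ML by simp
    then have "0 \<le> s * (W \<bullet> Z) + e" by (simp add: e_def inner_diff_right)
    moreover have "s * (W \<bullet> Z) = - (\<bar>e\<bar> + 1)" unfolding s_def using neg by (simp add: field_simps)
    ultimately show False by linarith
  qed
  have psdW: "psd (W $ i)" for i
    unfolding psd_def
  proof (intro conjI allI)
    \<comment> \<open>Skew matrices have zero quadratic form and so belong to \<open>C\<close>;
      testing \<open>W\<close> against its own skew part makes that part vanish.\<close>
    have "axis i (transpose (W $ i) - W $ i) \<in> C"
    proof -
      have "x \<bullet> ((transpose (W $ i) - W $ i) *v x) = 0" for x
        using dot_lmul_matrix[of x "W $ i" x]
        by (simp add: matrix_vector_mult_diff_rdistrib inner_diff_right inner_commute)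
      then show ?thesis unfolding C_def axis_def by auto
    qed
    then have "0 \<le> W $ i \<bullet> (transpose (W $ i) - W $ i)" using WC by (metis inner_axis)
    then have "(transpose (W $ i) - W $ i) \<bullet> (transpose (W $ i) - W $ i) \<le> 0"
      unfolding norm_transpose_diff by linarith
    then have "(transpose (W $ i) - W $ i) \<bullet> (transpose (W $ i) - W $ i) = 0"
      using inner_ge_zero order_antisym by blast
    then show "transpose (W $ i) = W $ i" by simp
    fix x
    have "axis i (outer x) \<in> C" by (rule C_psd) (simp add: axis_def psd_outer psd_0)
    then show "0 \<le> x \<bullet> (W $ i *v x)" using WC by (metis inner_axis inner_outer)
  qed
  have "\<mu> \<noteq> 0"
  proof
    assume \<mu>: "\<mu> = 0"
    \<comment> \<open>Here the choice of \<open>C\<close> enters: if \<open>W\<close> is orthogonal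
      to \<open>M\<close>, it vanishes on the ranges of the blocks of \<open>M\<close>, so
      \<open>- W\<close> lies in \<open>C\<close> too and \<open>W\<close> is zero.\<close>
    have "W \<bullet> M = 0" using sep[OF zC mem_ML, of "2 - g M"] WC[OF MC] \<mu> by simp
    then have "(\<Sum>i\<in>UNIV. W $ i \<bullet> M $ i) = 0" by (simp add: inner_vec_def)
    then have "W $ i \<bullet> M $ i = 0" for i
      using psd_inner_nonneg psdW psdM by (subst (asm) sum_nonneg_eq_0_iff) auto
    then have "W $ i *v (M $ i *v x) = 0" for i x using psd_inner_eq_0D psdW psdM by blast
    then have "- W \<in> C" unfolding C_def by (simp add: matrix_vector_mult_def sum_negf vec_eq_iff inner_vec_def)
    then have "W \<bullet> W \<le> 0" using WC[of "- W"] unfolding inner_minus_right by linarith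
    then have "W = 0" using inner_ge_zero[of W] by (metis inner_eq_zero_iff order_antisym)
    then show False using p(1) W\<mu> \<mu> by (simp add: zero_prod_def)
  qed
  with \<open>\<mu> \<ge> 0\<close> have \<mu>: "\<mu> > 0" by simp
  define W' where "W' = (1 / \<mu>) *\<^sub>R W"
  define h where "h Y = 1 - g Y - W' \<bullet> Y" for Y
  have h: "0 \<le> h Y" if "Y \<in> L" for Y
  proof -
    have "W' \<bullet> Y \<le> t" if "1 - g Y < t" for t
      using sep[OF zC \<open>Y \<in> L\<close> that] \<mu> by (simp add: W'_def field_simps)
    then have "W' \<bullet> Y \<le> 1 - g Y" by (rule dense_ge)
    then show ?thesis by (simp add: h_def)
  qed
  have const: "h (X b) = h (X b')" if "b \<in> I" "b' \<in> I" for b b'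
  proof (rule ccontr)
    assume ne: "h (X b) \<noteq> h (X b')"
    \<comment> \<open>An affine function bounded below on an affine space is constant:
      \<open>s\<close> marks the point on the line through \<open>X b\<close> and
      \<open>X b'\<close> where \<open>h\<close> would be -1.\<close>
    define s where "s = (h (X b) + 1) / (h (X b) - h (X b'))"
    have "(1 - s) *\<^sub>R X b + s *\<^sub>R X b' \<in> L" using mem_affine[OF affL] XL that by simp
    then have "0 \<le> h ((1 - s) *\<^sub>R X b + s *\<^sub>R X b')" by (rule h)
    also have "\<dots> = h (X b) - s * (h (X b) - h (X b'))"
      unfolding h_def g.add g.scale inner_add_right inner_scaleR_right real_scaleR_def
      by (simp add: algebra_simps)
    also have "\<dots> = -1" unfolding s_def using ne by simp
    finally show False by simp
  qed
  obtain b0 where b0: "b0 \<in> I" using I by blast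
  show ?thesis
  proof (intro exI conjI allI ballI)
    show "0 \<le> h (X b0)" using h XL b0 by blast
    show "psd (W' $ i)" for i unfolding W'_def using psd_scaleR[OF psdW] \<mu> by simp
    show "1 - g (X b) = W' \<bullet> X b + h (X b0)" if "b \<in> I" for b
      using const[OF that b0] by (simp add: h_def)
  qed
qed

section \<open>Slacks of the vertices of the correlation polytope\<close>

definition indicator_vec :: "'n set \<Rightarrow> real^'n" where
  "indicator_vec b = (\<chi> i. if i \<in> b then 1 else 0)"

lemma inner_indicator_vec: "indicator_vec a \<bullet> indicator_vec b = real (card (a \<inter> b))"
proof -
  have "indicator_vec a \<bullet> indicator_vec b = (\<Sum>i\<in>UNIV. if i \<in> a \<inter> b then 1 else 0)"
    unfolding inner_vec_def indicator_vec_def by (intro sum.cong) auto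
  then show ?thesis by (simp add: sum.If_cases Int_def)
qed

definition slack_form :: "'n set \<Rightarrow> real^'n^'n \<Rightarrow> real" where
  "slack_form a P = 2 * (\<Sum>i\<in>a. P $ i $ i) - P \<bullet> outer (indicator_vec a)"

lemma linear_slack_form: "linear (slack_form a)"
  unfolding slack_form_def
  by (intro linearI) (auto simp: sum.distrib inner_add_left algebra_simps sum_distrib_left)

text \<open>With \<open>k = card (a \<inter> b)\<close>, the form takes the value
  \<open>2 * k - k * k\<close> at the vertex.\<close>

lemma slack_form_vertex:
  "1 - slack_form a (outer (indicator_vec b)) = (1 - real (card (a \<inter> b)))\<^sup>2"
proof -
  have "(\<Sum>i\<in>a. outer (indicator_vec b) $ i $ i) = (\<Sum>i\<in>a. if i \<in> b then 1 else 0)"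
    by (intro sum.cong) (auto simp: outer_def indicator_vec_def)
  also have "\<dots> = real (card (a \<inter> b))" by (simp add: sum.If_cases)
  finally show ?thesis
    by (simp add: slack_form_def outer_inner_outer inner_indicator_vec Int_commute power2_eq_square
        algebra_simps)
qed

lemma vertex_mem_COR: "outer (indicator_vec b) \<in> COR"
  unfolding COR_def
  by (rule hull_inc, rule CollectI, rule exI[of _ "indicator_vec b"])
    (auto simp: outer_def indicator_vec_def)

lemma slack_form_COR_le:
  assumes "P \<in> COR"
  shows "slack_form a P \<le> 1"
proof -
  have "COR \<subseteq> {P. slack_form a P \<le> 1}"
    unfolding COR_def
  proof (rule hull_minimal)
    show "convex {P. slack_form a P \<le> 1}"
      using convex_linear_vimage[OF linear_slack_form convex_real_interval(2), of a 1]
      by (simp add: vimage_def)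
    show "{\<chi> i j. b $ i * b $ j |b. \<forall>i. b $ i \<in> {0, 1}} \<subseteq> {P. slack_form a P \<le> 1}"
    proof clarify
      fix b :: "real^'a" assume b: "\<forall>i. b $ i \<in> {0, 1}"
      have "b = indicator_vec {i. b $ i = 1}"
        using b by (auto simp: vec_eq_iff indicator_vec_def)
      then have "(\<chi> i j. b $ i * b $ j) = outer (indicator_vec {i. b $ i = 1})"
        by (metis outer_def)
      then show "slack_form a (\<chi> i j. b $ i * b $ j) \<le> 1"
        using slack_form_vertex[of a "{i. b $ i = 1}"] zero_le_power2 by (metis diff_ge_0_iff_ge)
    qed
  qed
  then show ?thesis using assms by blast
qed

text \<open>For Gram vectors of positive semidefinite matrices this is the vanishing of the inner
  product; adding matrices corresponds to uniting sets.\<close>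

definition orthogonal_sets :: "'v::real_inner set \<Rightarrow> 'v set \<Rightarrow> bool" where
  "orthogonal_sets U V \<longleftrightarrow> (\<forall>u\<in>U. \<forall>v\<in>V. u \<bullet> v = 0)"

text \<open>\<open>V\<close> collects Gram vectors of the lifted vertices, \<open>U\<close> those of
  the duality certificates, with identity blocks for \<open>a = {}\<close>. Of the slack matrix only
  the pattern of zeros and nonzeros is kept.\<close>

lemma COR_lift_factorization:
  fixes R :: "'r::finite set"
  assumes "has_psd_lift TYPE('d::finite) R (COR :: (real^'n^'n) set)"
  shows "\<exists>(U :: 'r \<Rightarrow> 'n set \<Rightarrow> (real^'d) set) V.
    (\<forall>i a b. card (a \<inter> b) = 1 \<longrightarrow> orthogonal_sets (U i a) (V i b)) \<and>
    (\<forall>a b. a \<inter> b = {} \<longrightarrow> (\<exists>i\<in>R. \<not> orthogonal_sets (U i a) (V i b)))"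
proof -
  obtain L and \<pi> :: "real^'d^'d^'r \<Rightarrow> real^'n^'n" where
    L: "affine L" "L \<subseteq> sym_tuples R" and \<pi>: "linear \<pi>" and COR: "COR = \<pi> ` (psd_tuples R \<inter> L)"
    using assms unfolding has_psd_lift_def by (elim exE conjE)
  interpret \<pi>: linear \<pi> by fact
  have "\<exists>Y. Y \<in> psd_tuples R \<and> Y \<in> L \<and> \<pi> Y = outer (indicator_vec b)" for b
  proof -
    have "outer (indicator_vec b) \<in> \<pi> ` (psd_tuples R \<inter> L)"
      using vertex_mem_COR[of b] COR by simp
    then show ?thesis by auto
  qed
  then obtain X where X: "\<And>b. X b \<in> psd_tuples R" "\<And>b. X b \<in> L"
    "\<And>b. \<pi> (X b) = outer (indicator_vec b)" by metis
  have X0: "X b $ i = 0" if "i \<notin> R" for b i using X(1) that unfolding psd_tuples_def by blast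
  have psdX: "psd (X b $ i)" for b i
    using X(1)[of b] psd_0 unfolding psd_tuples_def by (cases "i \<in> R") auto
  have psd_L: "\<pi> Y \<in> COR" if "Y \<in> L" "\<And>i. psd (Y $ i)" for Y
    using that L(2) unfolding COR psd_tuples_def sym_tuples_def by blast
  \<comment> \<open>If \<open>X b\<close> were zero, \<open>L\<close> would be closed under scaling,
    so twice the all-ones matrix would lie in the polytope and violate the inequality of a
    singleton.\<close>
  have X_nz: "X b \<noteq> 0" for b
  proof
    assume b: "X b = 0"
    have "(1 - 2) *\<^sub>R X b + 2 *\<^sub>R X UNIV \<in> L" by (rule mem_affine[OF L(1) X(2) X(2)]) simp
    then have "2 *\<^sub>R X UNIV \<in> L" by (simp add: b)
    then have "\<pi> (2 *\<^sub>R X UNIV) \<in> COR" using psd_L psd_scaleR[OF psdX] by simp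
    then have mem: "2 *\<^sub>R outer (indicator_vec UNIV) \<in> (COR :: (real^'n^'n) set)" by (simp add: \<pi>.scale X(3))
    fix j :: 'n
    have "slack_form {j} (outer (indicator_vec UNIV)) = 1"
      using slack_form_vertex[of "{j}" UNIV] by simp
    then show False
      using slack_form_COR_le[OF mem, of "{j}"] linear_cmul[OF linear_slack_form, of "{j}" 2] by simp
  qed
  have "\<exists>W c. 0 \<le> c \<and> (\<forall>i. psd (W $ i)) \<and>
      (\<forall>b\<in>UNIV. 1 - (slack_form a \<circ> \<pi>) (X b) = W \<bullet> X b + c)" for a
  proof (rule psd_duality_certificate)
    show "linear (slack_form a \<circ> \<pi>)" by (intro linear_compose \<pi> linear_slack_form)
    fix Y assume "Y \<in> affine hull range X" "\<And>i. psd (Y $ i)"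
    moreover have "affine hull range X \<subseteq> L" using X(2) L(1) by (intro hull_minimal) auto
    ultimately show "(slack_form a \<circ> \<pi>) Y \<le> 1" using psd_L slack_form_COR_le by (metis comp_apply subsetD)
  qed (use psdX in auto)
  then obtain W c where W: "\<And>a. 0 \<le> c a" "\<And>a i. psd (W a $ i)"
    "\<And>a b. (1 - real (card (a \<inter> b)))\<^sup>2 = W a \<bullet> X b + c a"
    by (simp add: X(3) slack_form_vertex) metis
  have Wn: "0 \<le> W a \<bullet> X b" for a b
    unfolding inner_vec_def[of "W a"] by (intro sum_nonneg psd_inner_nonneg W psdX)
  \<comment> \<open>A singleton \<open>{j}\<close> with \<open>j \<in> a\<close> has slack 0, and
    both summands are nonnegative.\<close>
  have c0: "c a = 0" if "a \<noteq> {}" for a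
  proof -
    obtain j where "j \<in> a" using \<open>a \<noteq> {}\<close> by blast
    then show ?thesis using W(1)[of a] W(3)[of a "{j}"] Wn[of a "{j}"] by simp
  qed
  \<comment> \<open>The constant \<open>c {}\<close> need not vanish; for \<open>a = {}\<close> only positivity of the sum matters, and
    traces provide it.\<close>
  define A where "A a = (if a = {} then (\<chi> i. mat 1) else W a)" for a
  have psdA: "psd (A a $ i)" for a i by (simp add: A_def W psd_mat_1)
  define us where "us i a = (SOME us. A a $ i = (\<Sum>u\<leftarrow>us. outer u))" for i a
  have us: "A a $ i = (\<Sum>u\<leftarrow>us i a. outer u)" for a i
    unfolding us_def using psd_imp_Gram[OF psdA] by (rule someI_ex)
  define vs where "vs i b = (SOME vs. X b $ i = (\<Sum>v\<leftarrow>vs. outer v))" for i b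
  have vs: "X b $ i = (\<Sum>v\<leftarrow>vs i b. outer v)" for b i
    unfolding vs_def using psd_imp_Gram[OF psdX] by (rule someI_ex)
  define U where "U i a = set (us i a)" for i a
  define V where "V i a = set (vs i a)" for i a
  have orth: "orthogonal_sets (U i a) (V i b) \<longleftrightarrow> A a $ i \<bullet> X b $ i = 0" for i a b
    unfolding orthogonal_sets_def U_def V_def us vs inner_Gram_eq_0_iff ..
  show ?thesis
  proof (intro exI conjI allI impI)
    fix i and a b :: "'n set" assume ab: "card (a \<inter> b) = 1"
    then have "a \<noteq> {}" by auto
    then have "(\<Sum>i\<in>UNIV. A a $ i \<bullet> X b $ i) = 0"
      using W(3)[of a b] c0[of a] ab by (simp add: A_def inner_vec_def)
    then have "A a $ i \<bullet> X b $ i = 0"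
      using psd_inner_nonneg[OF psdA psdX] by (subst (asm) sum_nonneg_eq_0_iff) auto
    then show "orthogonal_sets (U i a) (V i b)" by (simp add: orth)
  next
    fix a b :: "'n set" assume ab: "a \<inter> b = {}"
    have "\<exists>i. A a $ i \<bullet> X b $ i \<noteq> 0"
    proof (cases "a = {}")
      case True
      obtain i where i: "X b $ i \<noteq> 0" using X_nz[of b] by (auto simp: vec_eq_iff)
      have "A a $ i \<bullet> X b $ i \<noteq> 0"
      proof
        assume "A a $ i \<bullet> X b $ i = 0"
        then have "mat 1 *v (X b $ i *v x) = 0" for x
          using psd_inner_eq_0D[OF psdA psdX, of a i b i x] True by (simp add: A_def)
        then show False using i by (simp add: matrix_eq)
      qed
      then show ?thesis ..
    next
      case False
      then have "A a \<bullet> X b = 1" using W(3)[of a b] ab c0 by (simp add: A_def)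
      then show ?thesis by (auto simp: inner_vec_def[of "A a"] intro: ccontr)
    qed
    then show "\<exists>i\<in>R. \<not> orthogonal_sets (U i a) (V i b)" using X0 orth by (metis inner_zero_right)
  qed
qed

section \<open>Supports in the disjointness matrix\<close>

lemma orthogonal_sets_UN:
  "orthogonal_sets (\<Union>a\<in>A. U a) (\<Union>b\<in>B. V b) \<longleftrightarrow> (\<forall>a\<in>A. \<forall>b\<in>B. orthogonal_sets (U a) (V b))"
  unfolding orthogonal_sets_def by blast

lemma orthogonal_sets_commute: "orthogonal_sets U V \<longleftrightarrow> orthogonal_sets V U"
  unfolding orthogonal_sets_def by (metis inner_commute)

definition disjoint_pairs :: "'a set \<Rightarrow> ('a set \<times> 'a set) set" where
  "disjoint_pairs G = {(a, b). a \<subseteq> G \<and> b \<subseteq> G \<and> a \<inter> b = {}}"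

text \<open>The zeros that a term of the factorization inherits from the zero slacks; the bound on
  the support of a single term rests on these alone.\<close>

definition compatible :: "'a set \<Rightarrow> ('a set \<Rightarrow> 'v::real_inner set) \<Rightarrow> ('a set \<Rightarrow> 'v set) \<Rightarrow> bool" where
  "compatible G U V \<longleftrightarrow>
    (\<forall>a b. a \<subseteq> G \<longrightarrow> b \<subseteq> G \<longrightarrow> card (a \<inter> b) = 1 \<longrightarrow> orthogonal_sets (U a) (V b))"

definition support ::
  "'a set \<Rightarrow> ('a set \<Rightarrow> 'v::real_inner set) \<Rightarrow> ('a set \<Rightarrow> 'v set) \<Rightarrow> ('a set \<times> 'a set) set" where
  "support G U V = {(a, b) \<in> disjoint_pairs G. \<not> orthogonal_sets (U a) (V b)}"

lemma finite_disjoint_pairs: "finite G \<Longrightarrow> finite (disjoint_pairs G)"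
  by (rule finite_subset[of _ "Pow G \<times> Pow G"]) (auto simp: disjoint_pairs_def)

lemma support_subset: "support G U V \<subseteq> disjoint_pairs G"
  by (auto simp: support_def)

text \<open>Each element lies in the first set, in the second, or in neither.\<close>

lemma card_disjoint_pairs:
  fixes G :: "'a set"
  assumes "finite G"
  shows "card (disjoint_pairs G) = 3 ^ card G"
  using assms
proof (induction G rule: finite_induct)
  case empty
  have "disjoint_pairs ({} :: 'a set) = {({}, {})}" by (auto simp: disjoint_pairs_def)
  then show ?case by simp
next
  case (insert x G)
  let ?P = "disjoint_pairs G"
  let ?f = "\<lambda>(a, b). (insert x a, b)" and ?g = "\<lambda>(a, b). (a, insert x b)"
  have x: "x \<notin> a" "x \<notin> b" if "(a, b) \<in> ?P" for a b
    using that insert.hyps by (auto simp: disjoint_pairs_def)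
  have "disjoint_pairs (insert x G) = ?P \<union> (?f ` ?P \<union> ?g ` ?P)"
  proof (intro equalityI subsetI)
    fix p assume "p \<in> disjoint_pairs (insert x G)"
    then obtain a b where p: "p = (a, b)" and ab: "a \<subseteq> insert x G" "b \<subseteq> insert x G" "a \<inter> b = {}"
      by (auto simp: disjoint_pairs_def)
    consider "x \<in> a" "x \<notin> b" | "x \<in> b" "x \<notin> a" | "x \<notin> a" "x \<notin> b" using ab by blast
    then show "p \<in> ?P \<union> (?f ` ?P \<union> ?g ` ?P)"
    proof cases
      case 1
      then have "(a - {x}, b) \<in> ?P" "p = ?f (a - {x}, b)"
        using ab p by (auto simp: disjoint_pairs_def)
      then show ?thesis by blast
    next
      case 2
      then have "(a, b - {x}) \<in> ?P" "p = ?g (a, b - {x})"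
        using ab p by (auto simp: disjoint_pairs_def)
      then show ?thesis by blast
    next
      case 3
      then have "(a, b) \<in> ?P" using ab by (auto simp: disjoint_pairs_def)
      then show ?thesis using p by blast
    qed
  next
    fix p assume "p \<in> ?P \<union> (?f ` ?P \<union> ?g ` ?P)"
    then show "p \<in> disjoint_pairs (insert x G)"
      using insert.hyps by (auto simp: disjoint_pairs_def)
  qed
  moreover have "?P \<inter> (?f ` ?P \<union> ?g ` ?P) = {}" "?f ` ?P \<inter> ?g ` ?P = {}"
    using x by fastforce+
  moreover have "card (?f ` ?P) = card ?P" "card (?g ` ?P) = card ?P"
    using x by (intro card_image inj_onI; fastforce)+
  ultimately have "card (disjoint_pairs (insert x G)) = 3 * card ?P"
    using finite_disjoint_pairs[OF insert.hyps(1)] by (simp add: card_Un_disjoint)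
  then show ?case using insert by simp
qed

lemma card_filter_eq_sum: "finite A \<Longrightarrow> card {x \<in> A. P x} = (\<Sum>x\<in>A. of_bool (P x))"
  by (simp add: of_bool_def sum.inter_filter[symmetric])

text \<open>Which cells of a block are missing varies with the pair outside it, so the saving is
  stated through fixed rectangles: the sum over outer pairs can then be exchanged with the sum over
  \<open>J\<close>, and \<open>card J\<close> is the factor paid per block. The type argument fixes
  the vector space.\<close>

definition rectangle_cover ::
  "'v::real_inner itself \<Rightarrow> 'a set \<Rightarrow> 'j set \<Rightarrow> ('j \<Rightarrow> 'a set set) \<Rightarrow> ('j \<Rightarrow> 'a set set) \<Rightarrow> bool" where
  "rectangle_cover _ D J S T \<longleftrightarrow> finite J \<and> (\<forall>j\<in>J. S j \<times> T j \<subseteq> disjoint_pairs D) \<and>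
    (\<forall>(F :: 'a set \<Rightarrow> 'v set) H. compatible D F H \<longrightarrow>
      card (support D F H)
        \<le> card {j \<in> J. \<not> orthogonal_sets (\<Union>\<alpha>\<in>S j. F \<alpha>) (\<Union>\<beta>\<in>T j. H \<beta>)})"

text \<open>
  Summing the factors over the rows and columns of a rectangle of disjoint pairs in \<open>D\<close> yields
  a compatible pair of families on \<open>G\<close>; this reduces \<open>G \<union> D\<close> to \<open>G\<close>.
\<close>

lemma card_support_Un_le:
  fixes U V :: "'a set \<Rightarrow> 'v::real_inner set"
  assumes fin: "finite G" "finite D" and GD: "G \<inter> D = {}"
    and cover: "rectangle_cover TYPE('v) D J S T"
    and bound: "\<And>U V :: 'a set \<Rightarrow> 'v set. compatible G U V \<Longrightarrow> card (support G U V) \<le> N"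
    and comp: "compatible (G \<union> D) U V"
  shows "card (support (G \<union> D) U V) \<le> card J * N"
proof -
  have J: "finite J" and rect: "\<And>j. j \<in> J \<Longrightarrow> S j \<times> T j \<subseteq> disjoint_pairs D"
    and hits: "\<And>F H :: 'a set \<Rightarrow> 'v set. compatible D F H \<Longrightarrow> card (support D F H)
      \<le> card {j \<in> J. \<not> orthogonal_sets (\<Union>\<alpha>\<in>S j. F \<alpha>) (\<Union>\<beta>\<in>T j. H \<beta>)}"
    using cover unfolding rectangle_cover_def by blast+
  have orth: "orthogonal_sets (U a) (V b)"
    if "a \<subseteq> G \<union> D" "b \<subseteq> G \<union> D" "card (a \<inter> b) = 1" for a b
    using comp that unfolding compatible_def by blast
  \<comment> \<open>\<open>F p\<close> and \<open>H p\<close> fix the part \<open>p\<close> outside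
    the block and vary inside \<open>D\<close>; \<open>U' j\<close> and \<open>V' j\<close> merge
    the rows and columns of rectangle \<open>j\<close> and vary inside \<open>G\<close>.\<close>
  define F where "F p \<alpha> = U (fst p \<union> \<alpha>)" for p :: "'a set \<times> 'a set" and \<alpha>
  define H where "H p \<beta> = V (snd p \<union> \<beta>)" for p :: "'a set \<times> 'a set" and \<beta>
  define U' where "U' j a = (\<Union>\<alpha>\<in>S j. U (a \<union> \<alpha>))" for j a
  define V' where "V' j b = (\<Union>\<beta>\<in>T j. V (b \<union> \<beta>))" for j b
  let ?\<Sigma> = "SIGMA p:disjoint_pairs G. support D (F p) (H p)"
  have finG: "finite (disjoint_pairs G)" using fin(1) by (rule finite_disjoint_pairs)
  have finD: "finite (support D (F p) (H p))" for p
    by (rule finite_subset[OF support_subset finite_disjoint_pairs[OF fin(2)]])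
  have comp': "compatible D (F p) (H p)" if "p \<in> disjoint_pairs G" for p
    unfolding compatible_def
  proof (intro allI impI)
    fix \<alpha> \<beta> assume ab: "\<alpha> \<subseteq> D" "\<beta> \<subseteq> D" "card (\<alpha> \<inter> \<beta>) = 1"
    have p: "fst p \<subseteq> G" "snd p \<subseteq> G" "fst p \<inter> snd p = {}"
      using that by (auto simp: disjoint_pairs_def)
    have "(fst p \<union> \<alpha>) \<inter> (snd p \<union> \<beta>) = \<alpha> \<inter> \<beta>"
      using p ab(1,2) GD by blast
    then have "card ((fst p \<union> \<alpha>) \<inter> (snd p \<union> \<beta>)) = 1" using ab(3) by (rule ssubst)
    moreover have "fst p \<union> \<alpha> \<subseteq> G \<union> D" "snd p \<union> \<beta> \<subseteq> G \<union> D"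
      using p ab(1,2) by blast+
    ultimately show "orthogonal_sets (F p \<alpha>) (H p \<beta>)"
      unfolding F_def H_def by (intro orth)
  qed
  have comp'': "compatible G (U' j) (V' j)" if "j \<in> J" for j
    unfolding compatible_def U'_def V'_def orthogonal_sets_UN
  proof (intro allI impI ballI)
    fix a b \<alpha> \<beta> assume ab: "a \<subseteq> G" "b \<subseteq> G" "card (a \<inter> b) = 1" "\<alpha> \<in> S j" "\<beta> \<in> T j"
    then have "(\<alpha>, \<beta>) \<in> disjoint_pairs D" using rect that by blast
    then have \<alpha>\<beta>: "\<alpha> \<subseteq> D" "\<beta> \<subseteq> D" "\<alpha> \<inter> \<beta> = {}" by (auto simp: disjoint_pairs_def)
    have "(a \<union> \<alpha>) \<inter> (b \<union> \<beta>) = a \<inter> b" using \<alpha>\<beta> ab(1,2) GD by blast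
    then have "card ((a \<union> \<alpha>) \<inter> (b \<union> \<beta>)) = 1" using ab(3) by (rule ssubst)
    moreover have "a \<union> \<alpha> \<subseteq> G \<union> D" "b \<union> \<beta> \<subseteq> G \<union> D" using ab(1,2) \<alpha>\<beta> by blast+
    ultimately show "orthogonal_sets (U (a \<union> \<alpha>)) (V (b \<union> \<beta>))"
      by (intro orth)
  qed
  have "support (G \<union> D) U V \<subseteq> (\<lambda>(p, \<alpha>, \<beta>). (fst p \<union> \<alpha>, snd p \<union> \<beta>)) ` ?\<Sigma>"
  proof clarify
    fix a b assume "(a, b) \<in> support (G \<union> D) U V"
    then have ab: "a \<subseteq> G \<union> D" "b \<subseteq> G \<union> D" "a \<inter> b = {}" "\<not> orthogonal_sets (U a) (V b)"
      by (auto simp: support_def disjoint_pairs_def)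
    have a: "(a \<inter> G) \<union> (a \<inter> D) = a" "(b \<inter> G) \<union> (b \<inter> D) = b" using ab by auto
    then have "((a \<inter> G, b \<inter> G), (a \<inter> D, b \<inter> D)) \<in> ?\<Sigma>"
      using ab by (auto simp: support_def disjoint_pairs_def F_def H_def)
    then show "(a, b) \<in> (\<lambda>(p, \<alpha>, \<beta>). (fst p \<union> \<alpha>, snd p \<union> \<beta>)) ` ?\<Sigma>"
      by (rule rev_image_eqI) (simp add: a)
  qed
  then have "card (support (G \<union> D) U V) \<le> card ?\<Sigma>"
    using finG finD by (intro surj_card_le) auto
  also have "\<dots> = (\<Sum>p\<in>disjoint_pairs G. card (support D (F p) (H p)))"
    using finG finD by (simp add: card_SigmaI)
  also have "\<dots> \<le> (\<Sum>p\<in>disjoint_pairs G.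
      card {j \<in> J. \<not> orthogonal_sets (\<Union>\<alpha>\<in>S j. F p \<alpha>) (\<Union>\<beta>\<in>T j. H p \<beta>)})"
    by (intro sum_mono hits comp')
  also have "\<dots> = (\<Sum>p\<in>disjoint_pairs G. \<Sum>j\<in>J.
      of_bool (\<not> orthogonal_sets (U' j (fst p)) (V' j (snd p))))"
    by (simp add: card_filter_eq_sum J F_def H_def U'_def V'_def)
  \<comment> \<open>Double counting: for fixed \<open>j\<close>, the outer pairs that meet rectangle
    \<open>j\<close> form the support of the merged families.\<close>
  also have "\<dots> = (\<Sum>j\<in>J. \<Sum>p\<in>disjoint_pairs G.
      of_bool (\<not> orthogonal_sets (U' j (fst p)) (V' j (snd p))))"
    by (rule sum.swap)
  also have "\<dots> = (\<Sum>j\<in>J. card (support G (U' j) (V' j)))"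
    by (simp add: card_filter_eq_sum[OF finG, symmetric] support_def case_prod_beta')
  also have "\<dots> \<le> (\<Sum>j\<in>J. N)" by (intro sum_mono bound comp'')
  finally show ?thesis by simp
qed

text \<open>Each block of \<open>d\<close> elements contributes a factor \<open>K\<close>; the
  \<open>s\<close> leftover elements contribute the trivial \<open>3 ^ s\<close>.\<close>

lemma card_support_le:
  fixes U V :: "'a set \<Rightarrow> 'v::real_inner set"
  assumes cover: "\<And>D :: 'a set. finite D \<Longrightarrow> card D = d \<Longrightarrow>
      \<exists>(J :: 'j set) S T. rectangle_cover TYPE('v) D J S T \<and> card J = K"
    and "finite G" "card G = d * q + s" "compatible G U V"
  shows "card (support G U V) \<le> K ^ q * 3 ^ s"
  using assms(2-)
proof (induction q arbitrary: G U V)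
  case 0
  then show ?case
    using card_mono[OF finite_disjoint_pairs support_subset, of G U V] by (simp add: card_disjoint_pairs)
next
  case (Suc q)
  have "d \<le> card G" using Suc.prems by simp
  then obtain D where D: "D \<subseteq> G" "card D = d" "finite D" by (rule obtain_subset_with_card_n)
  obtain J :: "'j set" and S T where J: "rectangle_cover TYPE('v) D J S T" "card J = K"
    using cover D by blast
  have G: "(G - D) \<union> D = G" using D by blast
  have "card (G - D) = d * q + s" using D Suc.prems by (simp add: card_Diff_subset)
  then have "card (support (G - D) U V) \<le> K ^ q * 3 ^ s"
    if "compatible (G - D) U V" for U V :: "'a set \<Rightarrow> 'v set"
    using Suc.IH Suc.prems(1) that by simp
  moreover have "compatible ((G - D) \<union> D) U V" using Suc.prems G by simp
  ultimately have "card (support ((G - D) \<union> D) U V) \<le> card J * (K ^ q * 3 ^ s)"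
    using Suc.prems(1) D(3) J(1) by (intro card_support_Un_le) auto
  then show ?case unfolding G J(2) by (simp add: mult.assoc)
qed

section \<open>Rectangle covers\<close>

text \<open>The \<open>v i\<close> are independent, since \<open>u k\<close> is orthogonal to all
  earlier \<open>v j\<close> but not to \<open>v k\<close>.\<close>

lemma triangular_inner_le_DIM:
  fixes u v :: "nat \<Rightarrow> 'v::euclidean_space"
  assumes diag: "\<And>i. i < m \<Longrightarrow> u i \<bullet> v i \<noteq> 0"
    and tri: "\<And>i j. i < m \<Longrightarrow> j < i \<Longrightarrow> u i \<bullet> v j = 0"
  shows "m \<le> DIM('v)"
proof -
  have "independent (v ` {..<k}) \<and> card (v ` {..<k}) = k" if "k \<le> m" for k
    using that
  proof (induction k)
    case 0
    then show ?case by (simp add: independent_empty)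
  next
    case (Suc k)
    have "v k \<notin> span (v ` {..<k})"
    proof
      assume "v k \<in> span (v ` {..<k})"
      then have "orthogonal (u k) (v k)"
        by (rule orthogonal_to_span) (use tri Suc.prems in \<open>auto simp: orthogonal_def\<close>)
      then show False using diag[of k] Suc.prems by (simp add: orthogonal_def)
    qed
    moreover from this have "v k \<notin> v ` {..<k}" by (metis span_base)
    ultimately show ?case
      using Suc by (simp add: lessThan_Suc independent_insert)
  qed
  from this[OF order_refl] show ?thesis using independent_bound[of "v ` {..<m}"] by simp
qed

lemma compatible_chain_orthogonal:
  fixes F H :: "'a set \<Rightarrow> 'v::euclidean_space set"
  assumes comp: "compatible D F H" and D: "D = x ` {..<DIM('v)}" and inj: "inj_on x {..<DIM('v)}"
  shows "\<exists>i\<le>DIM('v). orthogonal_sets (F (x ` {..<i})) (H (if i < DIM('v) then {x i} else {}))"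
proof (rule ccontr)
  define \<alpha> where "\<alpha> i = x ` {..<i}" for i :: nat
  define \<beta> where "\<beta> i = (if i < DIM('v) then {x i} else {})" for i
  assume "\<not> ?thesis"
  then have "\<forall>i. i \<le> DIM('v) \<longrightarrow> (\<exists>u v. u \<in> F (\<alpha> i) \<and> v \<in> H (\<beta> i) \<and> u \<bullet> v \<noteq> 0)"
    unfolding orthogonal_sets_def \<alpha>_def \<beta>_def by blast
  then obtain u v where uv: "\<And>i. i \<le> DIM('v) \<Longrightarrow> u i \<in> F (\<alpha> i) \<and> v i \<in> H (\<beta> i) \<and> u i \<bullet> v i \<noteq> 0"
    by metis
  have "DIM('v) + 1 \<le> DIM('v)"
  proof (rule triangular_inner_le_DIM)
    fix i assume "i < DIM('v) + 1"
    then show "u i \<bullet> v i \<noteq> 0" using uv by simp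
    fix j assume "j < i"
    \<comment> \<open>As \<open>j < i\<close>, the index \<open>j\<close> is never the last one, so
      \<open>\<beta> j\<close> is a singleton; the empty set occurs only at
      \<open>DIM('v)\<close>.\<close>
    have "\<alpha> i \<inter> \<beta> j = {x j}" using \<open>j < i\<close> \<open>i < DIM('v) + 1\<close> by (auto simp: \<alpha>_def \<beta>_def)
    moreover have "\<alpha> i \<subseteq> D" "\<beta> j \<subseteq> D"
      using \<open>j < i\<close> \<open>i < DIM('v) + 1\<close> by (auto simp: \<alpha>_def \<beta>_def D)
    ultimately have "orthogonal_sets (F (\<alpha> i)) (H (\<beta> j))"
      using comp unfolding compatible_def by simp
    then show "u i \<bullet> v j = 0"
      using uv[of i] uv[of j] \<open>j < i\<close> \<open>i < DIM('v) + 1\<close> unfolding orthogonal_sets_def by simp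
  qed
  then show False by simp
qed

lemma compatible_support_neq:
  fixes F H :: "'a set \<Rightarrow> 'v::euclidean_space set"
  assumes comp: "compatible D F H" and D: "finite D" "card D = DIM('v)"
  shows "support D F H \<noteq> disjoint_pairs D"
proof -
  obtain x where "bij_betw x {0..<DIM('v)} D"
    using ex_bij_betw_nat_finite[OF D(1)] D(2) by auto
  then have x: "inj_on x {..<DIM('v)}" "D = x ` {..<DIM('v)}"
    by (auto simp: bij_betw_def atLeast0LessThan)
  obtain i where i: "i \<le> DIM('v)"
    "orthogonal_sets (F (x ` {..<i})) (H (if i < DIM('v) then {x i} else {}))"
    using compatible_chain_orthogonal[OF comp x(2,1)] by blast
  have "x i \<notin> x ` {..<i}" if "i < DIM('v)"
    using inj_on_image_mem_iff[OF x(1), of i "{..<i}"] that by simp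
  then have "(x ` {..<i}, if i < DIM('v) then {x i} else {}) \<in> disjoint_pairs D"
    using i(1) x(2) by (auto simp: disjoint_pairs_def)
  then show ?thesis using i(2) unfolding support_def by auto
qed

text \<open>All rectangles share the cell \<open>({}, {})\<close>. If it is in the support, every
  rectangle is met, and some cell missing from the support pays for the omitted rectangle; otherwise
  each cell of the support has a rectangle of its own.\<close>

lemma star_rectangle_cover:
  fixes D :: "'a set"
  assumes D: "finite D" "card D = DIM('v::euclidean_space)"
  shows "rectangle_cover TYPE('v) D (disjoint_pairs D - {({}, {})})
    (\<lambda>p. {{}, fst p}) (\<lambda>p. {{}, snd p})"
  unfolding rectangle_cover_def
proof (intro conjI allI impI ballI)
  show "finite (disjoint_pairs D - {({}, {})})" using finite_disjoint_pairs D by blast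
  show "{{}, fst j} \<times> {{}, snd j} \<subseteq> disjoint_pairs D" if "j \<in> disjoint_pairs D - {({}, {})}" for j
    using that by (auto simp: disjoint_pairs_def)
  fix F H :: "'a set \<Rightarrow> 'v set"
  assume comp: "compatible D F H"
  have fin: "finite (disjoint_pairs D)" using finite_disjoint_pairs D by blast
  define hits where "hits = {j \<in> disjoint_pairs D - {({}, {})}.
    \<not> orthogonal_sets (\<Union>\<alpha>\<in>{{}, fst j}. F \<alpha>) (\<Union>\<beta>\<in>{{}, snd j}. H \<beta>)}"
  have "card (support D F H) \<le> card hits"
  proof (cases "({}, {}) \<in> support D F H")
    case True
    then have "hits = disjoint_pairs D - {({}, {})}"
      unfolding hits_def orthogonal_sets_UN by (auto simp: support_def)
    moreover have "({}, {}) \<in> disjoint_pairs D" by (simp add: disjoint_pairs_def)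
    ultimately have "card hits = card (disjoint_pairs D) - 1" using fin by simp
    moreover have "card (support D F H) < card (disjoint_pairs D)"
      using compatible_support_neq[OF comp D] support_subset fin by (metis psubsetI psubset_card_mono)
    ultimately show ?thesis by linarith
  next
    case False
    then have "support D F H \<subseteq> hits"
      unfolding hits_def orthogonal_sets_UN by (auto simp: support_def)
    then show ?thesis using fin by (intro card_mono) (auto simp: hits_def)
  qed
  then show "card (support D F H) \<le> card {j \<in> disjoint_pairs D - {({}, {})}.
    \<not> orthogonal_sets (\<Union>\<alpha>\<in>{{}, fst j}. F \<alpha>) (\<Union>\<beta>\<in>{{}, snd j}. H \<beta>)}"
    unfolding hits_def .
qed


lemma rectangle_cover_dim_2:
  fixes D :: "'a set"
  assumes D: "finite D" "card D = 2" and dim: "DIM('v::euclidean_space) = 2"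
  shows "\<exists>S T. rectangle_cover TYPE('v) D {..<7::nat} S T"
proof -
  obtain p q where pq: "D = {p, q}" "p \<noteq> q" using D by (auto simp: card_2_iff)
  have neq: "{p} \<noteq> {p, q}" "{q} \<noteq> {p, q}" "{p, q} \<noteq> {p}" "{p, q} \<noteq> {q}" "{p} \<noteq> {q}" "{q} \<noteq> {p}"
    using pq by auto
  have Pow: "Pow D = {{}, {p}, {q}, {p, q}}" by (auto simp: pq Pow_insert)
  have pairs: "disjoint_pairs D = {({}, {}), ({p}, {}), ({q}, {}), ({p, q}, {}),
      ({}, {p}), ({}, {q}), ({}, {p, q}), ({p}, {q}), ({q}, {p})}" (is "_ = ?R")
  proof (intro equalityI subsetI)
    fix x assume "x \<in> disjoint_pairs D"
    then obtain a b where x: "x = (a, b)" and disj: "a \<inter> b = {}" and "a \<in> Pow D" "b \<in> Pow D"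
      unfolding disjoint_pairs_def by blast
    then have "a \<in> {{}, {p}, {q}, {p, q}}" "b \<in> {{}, {p}, {q}, {p, q}}"
      unfolding Pow by blast+
    then show "x \<in> ?R"
      using disj pq(2) unfolding x by (elim insertE emptyE; hypsubst; simp)
  next
    fix x assume "x \<in> ?R"
    then show "x \<in> disjoint_pairs D"
      unfolding disjoint_pairs_def pq(1) using pq(2) by (elim insertE emptyE; hypsubst; simp)
  qed
  \<comment> \<open>The thresholds encode multiplicities: the row and the column of
    \<open>{}\<close> and one of the two mixed squares count twice, the other square once. All
    contain \<open>({}, {})\<close>.\<close>
  define S :: "nat \<Rightarrow> 'a set set" where
    "S j = (if j < 2 then {{}} else if j < 4 then Pow D else if j < 6 then {{}, {q}} else {{}, {p}})" for j
  define T :: "nat \<Rightarrow> 'a set set" where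
    "T j = (if j < 2 then Pow D else if j < 4 then {{}} else if j < 6 then {{}, {p}} else {{}, {q}})" for j
  have "card (support D F H)
      \<le> card {j \<in> {..<7}. \<not> orthogonal_sets (\<Union>\<alpha>\<in>S j. F \<alpha>) (\<Union>\<beta>\<in>T j. H \<beta>)}"
    if comp: "compatible D F H" for F H :: "'a set \<Rightarrow> 'v set"
  proof -
    define P where "P a b = orthogonal_sets (F a) (H b)" for a b
    have chain: "orthogonal_sets (F' {}) (H' {x}) \<or> orthogonal_sets (F' {x}) (H' {y}) \<or> orthogonal_sets (F' D) (H' {})"
      if "compatible D F' H'" "D = {x, y}" "x \<noteq> y" for F' H' :: "'a set \<Rightarrow> 'v set" and x y
    proof -
      define f where "f i = (if i = 0 then x else y)" for i :: nat
      have "{..<2} = {0, 1 :: nat}" by auto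
      then have "D = f ` {..<DIM('v)}" "inj_on f {..<DIM('v)}"
        using that by (auto simp: dim f_def inj_on_def)
      from compatible_chain_orthogonal[OF that(1) this]
      obtain i where i: "i \<le> 2" "orthogonal_sets (F' (f ` {..<i})) (H' (if i < 2 then {f i} else {}))"
        by (auto simp: dim)
      consider "i = 0" | "i = 1" | "i = 2" using i(1) by linarith
      then show ?thesis
      proof cases
        case 1
        then show ?thesis using i(2) by (simp add: f_def)
      next
        case 2
        then have "f ` {..<i} = {x}" "(if i < 2 then {f i} else {}) = {y}" by (auto simp: f_def)
        then show ?thesis using i(2) by simp
      next
        case 3
        then have "f ` {..<i} = D" using that(2) \<open>{..<2} = {0, 1}\<close> by (auto simp: f_def)
        then show ?thesis using i(2) 3 by simp
      qed
    qed
    have comp': "compatible D H F"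
      unfolding compatible_def
    proof (intro allI impI)
      fix a b :: "'a set" assume ab: "a \<subseteq> D" "b \<subseteq> D" "card (a \<inter> b) = 1"
      then have "orthogonal_sets (F b) (H a)"
        using comp unfolding compatible_def by (simp add: Int_commute)
      then show "orthogonal_sets (H a) (F b)" by (simp only: orthogonal_sets_commute[of "H a"])
    qed
    have qp: "D = {q, p}" "q \<noteq> p" using pq by auto
    \<comment> \<open>The chain is used for both orders of \<open>p\<close>, \<open>q\<close>, then
      with the factors exchanged. No cell occurs in more than two of the four disjunctions, so at
      least two of the nine cells vanish.\<close>
    have c1: "P {} {p} \<or> P {p} {q} \<or> P {p, q} {}" and c2: "P {} {q} \<or> P {q} {p} \<or> P {p, q} {}"
      using chain[OF comp pq] chain[OF comp qp] by (simp_all only: P_def pq(1))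
    have c3: "P {p} {} \<or> P {q} {p} \<or> P {} {p, q}" and c4: "P {q} {} \<or> P {p} {q} \<or> P {} {p, q}"
      using chain[OF comp' pq] chain[OF comp' qp]
      by (simp_all only: P_def pq(1) orthogonal_sets_commute[of "F _"])
    have "card (support D F H) = (\<Sum>(a, b)\<in>disjoint_pairs D. of_bool (\<not> P a b))"
      using card_filter_eq_sum[OF finite_disjoint_pairs[OF D(1)], of "\<lambda>(a, b). \<not> P a b"]
      by (simp add: support_def P_def case_prod_beta')
    also have "\<dots> = of_bool (\<not> P {} {}) + of_bool (\<not> P {p} {}) + of_bool (\<not> P {q} {}) +
        of_bool (\<not> P {p, q} {}) + of_bool (\<not> P {} {p}) + of_bool (\<not> P {} {q}) +
        of_bool (\<not> P {} {p, q}) + of_bool (\<not> P {p} {q}) + of_bool (\<not> P {q} {p})"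
      unfolding pairs using pq(2) neq by simp
    \<comment> \<open>If \<open>P {} {}\<close> fails, all seven rectangles are met and at most
      seven cells are left; otherwise the claim is a finite Boolean check.\<close>
    also have "\<dots> \<le> 2 * of_bool (\<not> (P {} {} \<and> P {} {p} \<and> P {} {q} \<and> P {} {p, q})) +
        2 * of_bool (\<not> (P {} {} \<and> P {p} {} \<and> P {q} {} \<and> P {p, q} {})) +
        2 * of_bool (\<not> (P {} {} \<and> P {} {p} \<and> P {q} {} \<and> P {q} {p})) +
        of_bool (\<not> (P {} {} \<and> P {} {q} \<and> P {p} {} \<and> P {p} {q}))"
      using c1 c2 c3 c4
      by (cases "P {} {}"; cases "P {} {p}"; cases "P {} {q}"; cases "P {p} {}"; cases "P {q} {}";
          cases "P {p} {q}"; cases "P {q} {p}"; simp)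
    also have "\<dots> = (\<Sum>j<7. of_bool (\<not> (\<forall>a\<in>S j. \<forall>b\<in>T j. P a b)))"
      unfolding S_def T_def Pow by (simp add: eval_nat_numeral)
    also have "\<dots> = card {j \<in> {..<7}. \<not> orthogonal_sets (\<Union>\<alpha>\<in>S j. F \<alpha>) (\<Union>\<beta>\<in>T j. H \<beta>)}"
      unfolding card_filter_eq_sum[OF finite_lessThan] orthogonal_sets_UN P_def ..
    finally show ?thesis .
  qed
  moreover have "S j \<times> T j \<subseteq> disjoint_pairs D" for j
    unfolding S_def T_def disjoint_pairs_def using pq by auto
  ultimately show ?thesis unfolding rectangle_cover_def by blast
qed

section \<open>The lower bounds\<close>

text \<open>The supports of the terms cover all disjoint pairs, and each has at most
  \<open>K ^ q * 3 ^ s\<close> elements; the factor \<open>3 ^ s\<close> cancels.\<close>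

lemma COR_lift_card_bound:
  fixes R :: "'r::finite set"
  assumes lift: "has_psd_lift TYPE('d::finite) R (COR :: (real^'n^'n) set)"
    and cover: "\<And>D :: 'n set. finite D \<Longrightarrow> card D = CARD('d) \<Longrightarrow>
      \<exists>(J :: 'j set) S T. rectangle_cover TYPE(real^'d) D J S T \<and> card J = K"
    and n: "CARD('n) = CARD('d) * q + s"
  shows "(3 ^ CARD('d)) ^ q \<le> real (card R) * real K ^ q"
proof -
  obtain U V :: "'r \<Rightarrow> 'n set \<Rightarrow> (real^'d) set" where
    comp: "\<And>i a b. card (a \<inter> b) = 1 \<Longrightarrow> orthogonal_sets (U i a) (V i b)" and
    hit: "\<And>a b. a \<inter> b = {} \<Longrightarrow> \<exists>i\<in>R. \<not> orthogonal_sets (U i a) (V i b)"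
    using COR_lift_factorization[OF lift] by blast
  have "3 ^ CARD('n) = card (disjoint_pairs (UNIV :: 'n set))" by (simp add: card_disjoint_pairs)
  also have "\<dots> \<le> card (\<Union>i\<in>R. support UNIV (U i) (V i))"
  proof (rule card_mono)
    show "disjoint_pairs (UNIV :: 'n set) \<subseteq> (\<Union>i\<in>R. support UNIV (U i) (V i))"
    proof clarify
      fix a b assume ab: "(a, b) \<in> disjoint_pairs (UNIV :: 'n set)"
      then obtain i where "i \<in> R" "\<not> orthogonal_sets (U i a) (V i b)"
        using hit[of a b] by (auto simp: disjoint_pairs_def)
      then show "(a, b) \<in> (\<Union>i\<in>R. support UNIV (U i) (V i))" using ab by (auto simp: support_def)
    qed
  qed simp
  also have "\<dots> \<le> (\<Sum>i\<in>R. card (support UNIV (U i) (V i)))" by (rule card_UN_le) simp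
  also have "\<dots> \<le> (\<Sum>i\<in>R. K ^ q * 3 ^ s)"
  proof (rule sum_mono)
    fix i
    have "compatible UNIV (U i) (V i)" using comp by (simp add: compatible_def)
    then show "card (support UNIV (U i) (V i)) \<le> K ^ q * 3 ^ s"
      using n by (intro card_support_le[OF cover]) auto
  qed
  finally have "(3 ^ CARD('d)) ^ q * 3 ^ s \<le> card R * K ^ q * 3 ^ s"
    by (simp add: n power_add power_mult)
  then have "(3 ^ CARD('d)) ^ q \<le> card R * K ^ q" by simp
  then have "real ((3 ^ CARD('d)) ^ q) \<le> real (card R * K ^ q)" by (rule of_nat_mono)
  then show ?thesis by simp
qed

section \<open>The constants of the bounds\<close>

lemma lift_base_eq:
  assumes "d \<ge> 1"
  shows "lift_base d = (3 ^ d / (3 ^ d - 1)) powr (1 / real d)"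
proof -
  have "(3::real) ^ d > 1" using assms by (simp add: one_less_power)
  then have "1 - 1 / (3::real) ^ d = inverse (3 ^ d / (3 ^ d - 1))" "3 ^ d / (3 ^ d - 1) > (0::real)"
    by (auto simp: field_simps)
  then show ?thesis unfolding lift_base_def by (simp add: powr_minus inverse_powr powr_divide)
qed

lemma lift_base_gt_1: "d \<ge> 1 \<Longrightarrow> lift_base d > 1"
proof -
  assume d: "d \<ge> 1"
  then have "(3::real) ^ d > 1" by (simp add: one_less_power)
  then have "(3::real) ^ d / (3 ^ d - 1) > 1" by (simp add: field_simps)
  then show "lift_base d > 1" unfolding lift_base_eq[OF d] using d by simp
qed

text \<open>The power of the base is \<open>\<rho> ^ q\<close> times
  \<open>\<rho> powr (s / d)\<close>. As \<open>s\<close> is at most \<open>d - 1\<close> and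
  \<open>\<rho> \<le> K\<close>, the second factor is at most \<open>K powr (1 - 1 / d)\<close>, the
  inverse of \<open>lift_factor d\<close>.\<close>

lemma lift_bound_le_power:
  assumes d: "d \<ge> 1" and s: "s < d"
  shows "lift_factor d * lift_base d ^ (d * q + s) \<le> (3 ^ d / (3 ^ d - 1)) ^ q"
proof -
  define K \<rho> :: real where "K = 3 ^ d - 1" and "\<rho> = 3 ^ d / (3 ^ d - 1)"
  have "(3::real) ^ 1 \<le> 3 ^ d" using d by (intro power_increasing) auto
  then have K: "K \<ge> 2" by (simp add: K_def)
  have \<rho>K: "\<rho> = (K + 1) / K" by (simp add: K_def \<rho>_def)
  have \<rho>: "\<rho> > 1" using K by (simp add: \<rho>K)
  have "2 * K \<le> K * K" using K by (intro mult_right_mono) auto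
  then have "K + 1 \<le> K * K" using K by linarith
  then have "\<rho> \<le> K" using K by (simp add: \<rho>K divide_le_eq)
  have base: "lift_base d ^ k = \<rho> powr (real k / real d)" for k
  proof -
    have "lift_base d = \<rho> powr (1 / real d)" by (simp only: lift_base_eq[OF d] \<rho>_def)
    then show ?thesis
      using \<rho> powr_realpow[of "\<rho> powr (1 / real d)" k] by (simp add: powr_powr)
  qed
  have "real (d * q + s) / real d = real q + real s / real d" using d by (simp add: field_simps)
  then have "lift_base d ^ (d * q + s) = \<rho> ^ q * \<rho> powr (real s / real d)"
    using \<rho> by (simp only: base powr_add) (simp add: powr_realpow)
  moreover have "K powr (- (1 - 1 / real d)) * \<rho> powr (real s / real d) \<le> 1"
  proof -
    have "real s / real d \<le> 1 - 1 / real d" using d s by (simp add: field_simps)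
    then have "\<rho> powr (real s / real d) \<le> \<rho> powr (1 - 1 / real d)" using \<rho> by (intro powr_mono) auto
    also have "\<dots> \<le> K powr (1 - 1 / real d)" using \<rho> \<open>\<rho> \<le> K\<close> d by (intro powr_mono2) auto
    finally have "K powr (- (1 - 1 / real d)) * \<rho> powr (real s / real d)
        \<le> K powr (- (1 - 1 / real d)) * K powr (1 - 1 / real d)"
      by (intro mult_left_mono) auto
    also have "\<dots> = 1" using K by (simp add: powr_add[symmetric])
    finally show ?thesis .
  qed
  ultimately have "lift_factor d * lift_base d ^ (d * q + s) \<le> \<rho> ^ q * 1"
    using \<rho> unfolding lift_factor_def K_def[symmetric]
    by (simp only: mult.left_commute[of _ "\<rho> ^ q"], intro mult_left_mono) auto
  then show ?thesis by (simp add: \<rho>_def)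
qed

lemma COR_lift_lower_bound:
  fixes R :: "'r::finite set"
  assumes lift: "has_psd_lift TYPE('d::finite) R (COR :: (real^'n^'n) set)"
  shows "lift_factor CARD('d) * lift_base CARD('d) ^ CARD('n) \<le> real (card R)"
proof -
  let ?d = "CARD('d)" and ?q = "CARD('n) div CARD('d)" and ?s = "CARD('n) mod CARD('d)"
  have d: "?d \<ge> 1" by (simp add: Suc_leI)
  have "(3::nat) ^ ?d \<ge> 1" by simp
  have "(3 ^ ?d) ^ ?q \<le> real (card R) * real (3 ^ ?d - 1) ^ ?q"
  proof (rule COR_lift_card_bound[OF lift, where ?'j = "'n set \<times> 'n set" and s = ?s])
    fix D :: "'n set" assume D: "finite D" "card D = ?d"
    have "({}, {}) \<in> disjoint_pairs D" by (simp add: disjoint_pairs_def)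
    then have "card (disjoint_pairs D - {({}, {})}) = 3 ^ ?d - 1"
      using D finite_disjoint_pairs[OF D(1)] by (simp add: card_disjoint_pairs)
    moreover have "rectangle_cover TYPE(real^'d) D (disjoint_pairs D - {({}, {})})
        (\<lambda>p. {{}, fst p}) (\<lambda>p. {{}, snd p})"
      using D by (intro star_rectangle_cover) simp_all
    ultimately show "\<exists>(J :: ('n set \<times> 'n set) set) S T.
        rectangle_cover TYPE(real^'d) D J S T \<and> card J = 3 ^ ?d - 1"
      by blast
  qed simp
  moreover have "real (3 ^ ?d - 1) = 3 ^ ?d - 1" by (simp add: of_nat_diff)
  moreover have "(3::real) ^ ?d > 1" using d by (simp add: one_less_power)
  ultimately have "(3 ^ ?d / (3 ^ ?d - 1)) ^ ?q \<le> real (card R)"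
    by (simp add: power_divide divide_le_eq)
  moreover have "lift_factor ?d * lift_base ?d ^ (?d * ?q + ?s) \<le> (3 ^ ?d / (3 ^ ?d - 1)) ^ ?q"
    using d by (intro lift_bound_le_power) auto
  ultimately show ?thesis by simp
qed

lemma COR_lift_lower_bound_dim_2:
  fixes R :: "'r::finite set"
  assumes lift: "has_psd_lift TYPE('d::finite) R (COR :: (real^'n^'n) set)" and d: "CARD('d) = 2"
  shows "1 / sqrt 7 * sqrt (9 / 7) ^ CARD('n) \<le> real (card R)"
proof -
  let ?q = "CARD('n) div 2" and ?s = "CARD('n) mod 2"
  have "(3 ^ CARD('d)) ^ ?q \<le> real (card R) * real 7 ^ ?q"
  proof (rule COR_lift_card_bound[OF lift, where ?'j = nat and s = ?s])
    fix D :: "'n set" assume D: "finite D" "card D = CARD('d)"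
    then obtain S T where "rectangle_cover TYPE(real^'d) D {..<7::nat} S T"
      using rectangle_cover_dim_2[where ?'v = "real^'d", of D] d by auto
    then show "\<exists>(J :: nat set) S T. rectangle_cover TYPE(real^'d) D J S T \<and> card J = 7"
      by (metis card_lessThan)
  qed (simp add: d)
  then have "(9 / 7) ^ ?q \<le> real (card R)" by (simp add: d power_divide divide_le_eq)
  moreover have "sqrt (9 / 7) ^ CARD('n) = (9 / 7) ^ ?q * sqrt (9 / 7) ^ ?s"
  proof -
    have "sqrt (9 / 7) ^ (2 * ?q + ?s) = (9 / 7) ^ ?q * sqrt (9 / 7) ^ ?s"
      unfolding power_add power_mult by simp
    then show ?thesis by simp
  qed
  moreover have "1 / sqrt 7 * sqrt (9 / 7) ^ ?s \<le> (1::real)"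
  proof -
    \<comment> \<open>A remainder modulo 2 is at most 1, so the leftover factor is at most
      \<open>sqrt (9 / 7)\<close>, which the constant \<open>1 / sqrt 7\<close> absorbs.\<close>
    have "sqrt (9 / 7) ^ ?s \<le> sqrt (9 / 7) ^ 1" by (intro power_increasing) auto
    also have "\<dots> \<le> sqrt 7" by simp
    finally show ?thesis by simp
  qed
  then have "(9 / 7) ^ ?q * (1 / sqrt 7 * sqrt (9 / 7) ^ ?s) \<le> (9 / 7 :: real) ^ ?q * 1"
    by (intro mult_left_mono) auto
  ultimately show ?thesis by (simp add: mult_ac)
qed

theorem theorem1:
  fixes R :: "'r::finite set"
  shows "lift_base CARD('d::finite) > 1 \<and>
    (CARD('n::finite) \<ge> CARD('d) \<and> has_psd_lift TYPE('d) R (COR :: (real^'n^'n) set) \<longrightarrow>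
      real (card R) \<ge> lift_factor CARD('d) * lift_base CARD('d) ^ CARD('n)) \<and>
    (CARD('d) = 2 \<and> CARD('n) \<ge> 2 \<and> has_psd_lift TYPE('d) R (COR :: (real^'n^'n) set) \<longrightarrow>
      real (card R) \<ge> 1 / sqrt 7 * sqrt (9 / 7) ^ CARD('n))"
  using lift_base_gt_1[of "CARD('d)"] COR_lift_lower_bound COR_lift_lower_bound_dim_2
  by (metis One_nat_def Suc_leI zero_less_card_finite)

end
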